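(* Let $(X,\phi)$ be a compact metric flow without fixed points. Let $\mu\in\mathcal{E}_\phi(X)$ be an ergodic $\phi$-invariant Borel probability measure, let $E$ be a Borel subset of $X$, and let $0<s<\infty$. 1. If $\underline{h}_\mu(\phi,x)\le s$ for all $x\in E$, then $h_{top}^B(\phi,E)\le s$. 2. If $\underline{h}_\mu(\phi,x)\ge s$ for all $x\in E$ and $\mu(E)>0$, then $h_{top}^B(\phi,E)\ge s$.
   Context: A (compact metric) flow $(X,\phi)$ consists of a compact metric space $(X,d)$ and a continuous map $\phi:X\times\mathbb{R}\to X$ such that each $\phi_t:=\phi(\cdot,t)$ is a homeomorphism of $X$ and $\phi_t\circ\phi_s=\phi_{s+t}$ for all $s,t\in\mathbb{R}$. It is without fixed points if there is no $x\in X$ with $\phi_t(x)=x$ for all $t\in\mathbb{R}$. A Borel probability measure $\mu$ on $X$ is $\phi$-invariant if $\mu(\phi_t(B))=\mu(B)$ for all Borel $B$ and all $t\in\mathbb{R}$; it is ergodic if every $\phi$-invariant Borel set has measure $0$ or $1$. $\mathcal{E}_\phi(X)$ is the set of ergodic $\phi$-invariant Borel probability measures. For a closed interval $I$ containing $0$, a reparametrization on $I$ is a continuous map $\alpha:I\to\mathbb{R}$ that is a homeomorphism onto its image with $\alpha(0)=0$; $Rep(I)$ is the set of these, and $Rep[0,t]=Rep([0,t])$. For $x\in X$, $t\ge 0$, $\epsilon>0$ the reparametrization ball (an open set) is $$B(x,t,\epsilon,\phi)=\{y\in X:\exists\,\alpha\in Rep[0,t]\text{ such that } d(\phi_{\alpha(s)}x,\phi_s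 y)<\epsilon\ \ \forall\, 0\le s\le t\}.$$ The lower local entropy is $\underline{h}_\mu(\phi,x)=\lim_{\epsilon\to0}\liminf_{t\to\infty}-\frac1t\log\mu(B(x,t,\epsilon,\phi))$ (with $-\log 0=+\infty$). Bowen entropy: for $Z\subset X$, $s\ge 0$, $N\in\mathbb{N}$, $\epsilon>0$, put $\mathcal{M}^s_{N,\epsilon}(\phi,Z)=\inf\sum_i\exp(-st_i)$, where the infimum is over all finite or countable families $\{B(x_i,t_i,\epsilon,\phi)\}$ with $x_i\in X$, $t_i\ge N$ and $Z\subset\bigcup_i B(x_i,t_i,\epsilon,\phi)$. Put $\mathcal{M}^s_\epsilon(\phi,Z)=\lim_{N\to\infty}\mathcal{M}^s_{N,\epsilon}(\phi,Z)$ and $\mathcal{M}^s(\phi,Z)=\lim_{\epsilon\to0}\mathcal{M}^s_\epsilon(\phi,Z)$ (these limits exist). The Bowen entropy $h_{top}^B(\phi,Z)$ is the critical value of $s$ where $\mathcal{M}^s(\phi,Z)$ jumps from $\infty$ to $0$: $h_{top}^B(\phi,Z)=\inf\{s:\mathcal{M}^s(\phi,Z)=0\}=\sup\{s:\mathcal{M}^s(\phi,Z)=\infty\}$. *)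

theory Defs
  imports "HOL-Analysis.Analysis" "HOL-Probability.Probability_Measure"
begin

text \<open>The compact metric space is a whole type \<open>'a\<close> with \<open>compact UNIV\<close>, and \<open>\<phi> t\<close> is the
  time-\<open>t\<close> map \<open>\<phi>\<^sub>t\<close> of the flow.\<close>

definition compact_metric_flow :: "(real \<Rightarrow> 'a::metric_space \<Rightarrow> 'a) \<Rightarrow> bool" where
  "compact_metric_flow \<phi> \<longleftrightarrow>
     compact (UNIV :: 'a set) \<and>
     continuous_on UNIV (\<lambda>(x, t). \<phi> t x) \<and>
     (\<forall>t. \<exists>g. homeomorphism UNIV UNIV (\<phi> t) g) \<and>
     (\<forall>s t. \<phi> t \<circ> \<phi> s = \<phi> (s + t))"

definition without_fixed_points :: "(real \<Rightarrow> 'a \<Rightarrow> 'a) \<Rightarrow> bool" where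
  "without_fixed_points \<phi> \<longleftrightarrow> \<not> (\<exists>x. \<forall>t. \<phi> t x = x)"

definition invariant_measures :: "(real \<Rightarrow> 'a::metric_space \<Rightarrow> 'a) \<Rightarrow> 'a measure set" where
  "invariant_measures \<phi> =
     {\<mu>. prob_space \<mu> \<and> sets \<mu> = sets borel \<and>
         (\<forall>B\<in>sets borel. \<forall>t. measure \<mu> (\<phi> t ` B) = measure \<mu> B)}"

definition ergodic_measures :: "(real \<Rightarrow> 'a::metric_space \<Rightarrow> 'a) \<Rightarrow> 'a measure set" where
  "ergodic_measures \<phi> =
     {\<mu>\<in>invariant_measures \<phi>.
        \<forall>B\<in>sets borel. (\<forall>t. \<phi> t ` B = B) \<longrightarrow> measure \<mu> B = 0 \<or> measure \<mu> B = 1}"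

text \<open>Only the values of \<open>\<alpha>\<close> on \<open>I\<close> matter. As homeomorphisms onto the image, reparametrizations
  may be decreasing.\<close>

definition Rep :: "real set \<Rightarrow> (real \<Rightarrow> real) set" where
  "Rep I = {\<alpha>. (\<exists>\<beta>. homeomorphism I (\<alpha> ` I) \<alpha> \<beta>) \<and> \<alpha> 0 = 0}"

definition rep_ball :: "(real \<Rightarrow> 'a::metric_space \<Rightarrow> 'a) \<Rightarrow> 'a \<Rightarrow> real \<Rightarrow> real \<Rightarrow> 'a set" where
  "rep_ball \<phi> x t \<epsilon> =
     {y. \<exists>\<alpha>\<in>Rep {0..t}. \<forall>s\<in>{0..t}. dist (\<phi> (\<alpha> s) x) (\<phi> s y) < \<epsilon>}"

definition neg_log :: "real \<Rightarrow> ereal" where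
  "neg_log p = (if p = 0 then \<infinity> else ereal (- ln p))"

definition lower_local_entropy ::
    "(real \<Rightarrow> 'a::metric_space \<Rightarrow> 'a) \<Rightarrow> 'a measure \<Rightarrow> 'a \<Rightarrow> ereal" where
  "lower_local_entropy \<phi> \<mu> x =
     Lim (at_right 0) (\<lambda>\<epsilon>. Liminf at_top (\<lambda>t. neg_log (measure \<mu> (rep_ball \<phi> x t \<epsilon>)) / ereal t))"

text \<open>Countable covering families are indexed by arbitrary sets \<open>I\<close> of naturals, so finite (and empty)
  families are included.\<close>

definition bowen_M_N_eps ::
    "(real \<Rightarrow> 'a::metric_space \<Rightarrow> 'a) \<Rightarrow> 'a set \<Rightarrow> real \<Rightarrow> nat \<Rightarrow> real \<Rightarrow> ennreal" where
  "bowen_M_N_eps \<phi> Z s N \<epsilon> =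
     Inf {(\<Sum>\<^sub>\<infinity>i\<in>I. ennreal (exp (- s * t i))) | (I :: nat set) x t.
            (\<forall>i\<in>I. t i \<ge> real N) \<and> Z \<subseteq> (\<Union>i\<in>I. rep_ball \<phi> (x i) (t i) \<epsilon>)}"

definition bowen_M_eps ::
    "(real \<Rightarrow> 'a::metric_space \<Rightarrow> 'a) \<Rightarrow> 'a set \<Rightarrow> real \<Rightarrow> real \<Rightarrow> ennreal" where
  "bowen_M_eps \<phi> Z s \<epsilon> = lim (\<lambda>N. bowen_M_N_eps \<phi> Z s N \<epsilon>)"

definition bowen_M :: "(real \<Rightarrow> 'a::metric_space \<Rightarrow> 'a) \<Rightarrow> 'a set \<Rightarrow> real \<Rightarrow> ennreal" where
  "bowen_M \<phi> Z s = Lim (at_right 0) (\<lambda>\<epsilon>. bowen_M_eps \<phi> Z s \<epsilon>)"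

text \<open>The infimum is taken in \<open>ereal\<close>, so it is \<open>\<infinity>\<close> if no \<open>s \<ge> 0\<close> qualifies.\<close>

definition bowen_entropy :: "(real \<Rightarrow> 'a::metric_space \<Rightarrow> 'a) \<Rightarrow> 'a set \<Rightarrow> ereal" where
  "bowen_entropy \<phi> Z = Inf {ereal s | s. s \<ge> 0 \<and> bowen_M \<phi> Z s = 0}"

end

theory Submission
  imports Defs
begin

text \<open>In a flow without fixed points, small periods do not occur, so a reparametrization that keeps
  two orbits close for a long time \<open>t\<close> changes \<open>t\<close> only by a small factor. Up to such a factor in
  time and a factor \<open>2\<close> in the radius, reparametrization balls therefore behave like balls of a
  metric. The two inequalities are then mass distribution arguments: packing by disjoint balls of
  large measure bounds the Bowen entropy from above, and a cover by balls of small measure with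
  arbitrarily small total cost forces \<open>E\<close> to be a null set.\<close>

text \<open>The time lost when balls are compared is harmless because both entropies are exponential
  rates: shortening a ball from time \<open>t\<close> to \<open>c * t\<close> turns the cost
  \<open>exp (- s' * t)\<close> into \<open>exp (- s' * c * t)\<close>, and a strict gap between
  \<open>s\<close> and \<open>s'\<close> leaves room for a suitable \<open>c < 1\<close>. Hence both
  halves work with \<open>s'\<close> different from \<open>s\<close>, insert intermediate rates, and
  reach \<open>s\<close> only at the very end. The obstacle is that a reparametrization may a priori
  compress time strongly or even reverse it. Symmetry needs its inverse and transitivity a
  composition, and both are available only on the stretch of time that the images cover. A two-sided
  bound on \<open>\<alpha> t\<close> controls that stretch and also rules out decreasing
  maps.\<close>

definition distortion_bound :: "(real \<Rightarrow> 'a::metric_space \<Rightarrow> 'a) \<Rightarrow> real \<Rightarrow> real \<Rightarrow> bool" where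
  "distortion_bound \<phi> \<eta> \<epsilon> \<longleftrightarrow>
     (\<forall>x y t \<alpha>. 1 \<le> t \<longrightarrow> continuous_on {0..t} \<alpha> \<longrightarrow> \<alpha> 0 = 0 \<longrightarrow>
        (\<forall>s\<in>{0..t}. dist (\<phi> (\<alpha> s) x) (\<phi> s y) < \<epsilon>) \<longrightarrow> \<bar>\<alpha> t - t\<bar> \<le> \<eta> * t)"

lemma distortion_boundD:
  assumes "distortion_bound \<phi> \<eta> \<epsilon>" "1 \<le> t" "continuous_on {0..t} \<alpha>" "\<alpha> 0 = 0"
    "\<And>s. s \<in> {0..t} \<Longrightarrow> dist (\<phi> (\<alpha> s) x) (\<phi> s y) < \<epsilon>"
  shows "\<bar>\<alpha> t - t\<bar> \<le> \<eta> * t"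
  using assms unfolding distortion_bound_def by blast

section \<open>Flows without fixed points: periods and time distortion\<close>

context
  fixes \<phi> :: "real \<Rightarrow> 'a::metric_space \<Rightarrow> 'a"
  assumes flow: "compact_metric_flow \<phi>"
begin

lemma flow_add: "\<phi> t (\<phi> s x) = \<phi> (s + t) x"
proof -
  have "\<phi> t \<circ> \<phi> s = \<phi> (s + t)"
    using flow unfolding compact_metric_flow_def by blast
  then show ?thesis by (metis comp_apply)
qed

text \<open>The definition of a flow does not postulate this; it follows because
  \<open>\<phi> 0\<close> is idempotent by the flow law and injective as a homeomorphism.\<close>

lemma flow_zero: "\<phi> 0 x = x"
proof -
  obtain g where "homeomorphism UNIV UNIV (\<phi> 0) g"
    using flow unfolding compact_metric_flow_def by blast
  moreover have "\<phi> 0 (\<phi> 0 x) = \<phi> 0 x" by (simp add: flow_add)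
  ultimately show ?thesis by (metis UNIV_I homeomorphism_apply1)
qed

lemma flow_joint_continuous: "continuous_on UNIV (\<lambda>p. \<phi> (snd p) (fst p))"
  using flow unfolding compact_metric_flow_def by (simp add: case_prod_unfold)

lemma continuous_on_flow [continuous_intros]:
  assumes "continuous_on A f" "continuous_on A g"
  shows "continuous_on A (\<lambda>a. \<phi> (f a) (g a))"
  using continuous_on_compose2[OF flow_joint_continuous continuous_on_Pair[OF assms(2,1)]] by simp

lemma tendsto_flow:
  assumes "(f \<longlongrightarrow> a) F" "(g \<longlongrightarrow> b) F"
  shows "((\<lambda>i. \<phi> (f i) (g i)) \<longlongrightarrow> \<phi> a b) F"
proof -
  have "isCont (\<lambda>p. \<phi> (snd p) (fst p)) (b, a)"
    using flow_joint_continuous by (simp add: continuous_on_eq_continuous_at)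
  from isCont_tendsto_compose[OF this tendsto_Pair[OF assms(2,1)]] show ?thesis by simp
qed

lemma flow_compact: "compact (UNIV :: 'a set)"
  using flow unfolding compact_metric_flow_def by blast

lemma flow_period_multiple:
  assumes "\<phi> \<tau> x = x"
  shows "\<phi> (real n * \<tau>) x = x"
proof (induction n)
  case 0
  then show ?case by (simp add: flow_zero)
next
  case (Suc n)
  have "\<phi> (real (Suc n) * \<tau>) x = \<phi> \<tau> (\<phi> (real n * \<tau>) x)"
    by (simp add: flow_add algebra_simps)
  then show ?case using Suc assms by simp
qed

text \<open>Points of arbitrarily small period accumulate at a fixed point.\<close>

lemma periods_bounded_below:
  assumes "without_fixed_points \<phi>"
  obtains T where "T > 0" "\<And>\<tau> x. 0 < \<tau> \<Longrightarrow> \<tau> < T \<Longrightarrow> \<phi> \<tau> x \<noteq> x"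
proof (rule ccontr)
  assume "\<not> thesis"
  with that have "\<forall>n. \<exists>\<tau> x. 0 < \<tau> \<and> \<tau> < inverse (real (Suc n)) \<and> \<phi> \<tau> x = x"
    by (metis inverse_positive_iff_positive of_nat_0_less_iff zero_less_Suc)
  then obtain \<tau> x where \<tau>: "\<And>n. 0 < \<tau> n" "\<And>n. \<tau> n < inverse (real (Suc n))"
    and x: "\<And>n. \<phi> (\<tau> n) (x n) = x n"
    by metis
  obtain l r where r: "strict_mono (r :: nat \<Rightarrow> nat)" and l: "(x \<circ> r) \<longlonglongrightarrow> l"
    using flow_compact unfolding compact_eq_seq_compact_metric seq_compact_def by blast
  have "\<tau> \<longlonglongrightarrow> 0"
    by (rule tendsto_sandwich[OF _ _ tendsto_const LIMSEQ_inverse_real_of_nat])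
      (auto intro!: always_eventually less_imp_le \<tau> simp del: of_nat_Suc)
  then have \<tau>r: "(\<lambda>i. \<tau> (r i)) \<longlonglongrightarrow> 0"
    using LIMSEQ_subseq_LIMSEQ[OF _ r] by (auto simp: o_def)
  have nonneg: "\<phi> t l = l" if "t \<ge> 0" for t
  proof -
    \<comment> \<open>Rounding \<open>t\<close> down to a whole number of periods of
      \<open>x (r i)\<close> costs at most one period, which tends to 0. At the rounded times the
      points return to themselves, and this passes to the limit \<open>l\<close>.\<close>
    define k where "k i = nat \<lfloor>t / \<tau> (r i)\<rfloor>" for i
    have near: "t - \<tau> (r i) \<le> real (k i) * \<tau> (r i)" "real (k i) * \<tau> (r i) \<le> t" for i
    proof -
      have p: "0 < \<tau> (r i)" by (rule \<tau>)
      have k: "real (k i) = of_int \<lfloor>t / \<tau> (r i)\<rfloor>"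
        using p that unfolding k_def by simp
      have "real (k i) \<le> t / \<tau> (r i)" "t / \<tau> (r i) \<le> real (k i) + 1"
        unfolding k by linarith+
      then show "t - \<tau> (r i) \<le> real (k i) * \<tau> (r i)" "real (k i) * \<tau> (r i) \<le> t"
        using p by (simp_all add: field_simps)
    qed
    have "(\<lambda>i. real (k i) * \<tau> (r i)) \<longlonglongrightarrow> t"
    proof (rule tendsto_sandwich[OF _ _ _ tendsto_const])
      show "(\<lambda>i. t - \<tau> (r i)) \<longlonglongrightarrow> t"
        using tendsto_diff[OF tendsto_const \<tau>r, of t] by simp
    qed (auto intro!: always_eventually near)
    from tendsto_flow[OF this l] have "(\<lambda>i. \<phi> (real (k i) * \<tau> (r i)) (x (r i))) \<longlonglongrightarrow> \<phi> t l"
      by simp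
    moreover have "\<phi> (real (k i) * \<tau> (r i)) (x (r i)) = x (r i)" for i
      by (rule flow_period_multiple) (rule x)
    ultimately have "(\<lambda>i. x (r i)) \<longlonglongrightarrow> \<phi> t l" by simp
    with l show ?thesis by (intro LIMSEQ_unique) (simp_all add: o_def)
  qed
  have "\<phi> t l = l" for t
  proof (cases "t \<ge> 0")
    case False
    then have "\<phi> t l = \<phi> t (\<phi> (- t) l)" using nonneg[of "- t"] by simp
    then show ?thesis by (simp add: flow_add flow_zero)
  qed (rule nonneg)
  with assms show False unfolding without_fixed_points_def by blast
qed

lemma flow_displacement_bounded_below:
  assumes "\<And>x. \<phi> \<kappa> x \<noteq> x"
  obtains \<gamma> where "\<gamma> > 0" "\<And>x. \<gamma> \<le> dist (\<phi> \<kappa> x) x"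
proof -
  have "continuous_on UNIV (\<lambda>x. dist (\<phi> \<kappa> x) x)"
    by (intro continuous_intros)
  then obtain x0 where "\<And>x. dist (\<phi> \<kappa> x0) x0 \<le> dist (\<phi> \<kappa> x) x"
    using continuous_attains_inf[OF flow_compact] by blast
  then show thesis using that[of "dist (\<phi> \<kappa> x0) x0"] assms by simp
qed

lemma flow_equicontinuous:
  assumes "\<rho> > 0"
  obtains \<epsilon> where "\<epsilon> > 0"
    "\<And>x y r. dist x y < \<epsilon> \<Longrightarrow> 0 \<le> r \<Longrightarrow> r \<le> 1 \<Longrightarrow> dist (\<phi> r x) (\<phi> r y) < \<rho>"
proof -
  have "uniformly_continuous_on (UNIV \<times> {0..1}) (\<lambda>p. \<phi> (snd p) (fst p))"
    by (intro compact_uniformly_continuous compact_Times flow_compact compact_Icc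
        continuous_on_subset[OF flow_joint_continuous]) auto
  then obtain \<epsilon> where \<epsilon>: "\<epsilon> > 0" "\<And>p q. p \<in> UNIV \<times> {0..1} \<Longrightarrow> q \<in> UNIV \<times> {0..1} \<Longrightarrow>
      dist q p < \<epsilon> \<Longrightarrow> dist (\<phi> (snd q) (fst q)) (\<phi> (snd p) (fst p)) < \<rho>"
    using assms unfolding uniformly_continuous_on_def by metis
  show thesis
  proof (rule that[OF \<epsilon>(1)])
    fix x y :: 'a and r :: real
    assume "dist x y < \<epsilon>" "0 \<le> r" "r \<le> 1"
    then show "dist (\<phi> r x) (\<phi> r y) < \<rho>"
      using \<epsilon>(2)[of "(y, r)" "(x, r)"] by (simp add: dist_Pair_Pair)
  qed
qed

text \<open>Over unit time the defect \<open>\<alpha> (s + r) - \<alpha> s - r\<close> starts at \<open>0\<close> and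
  cannot reach \<open>\<plusminus>\<kappa>\<close>, because the flow at time \<open>\<kappa>\<close> displaces every point by a definite amount.\<close>

lemma reparametrization_distortion:
  assumes nofix: "without_fixed_points \<phi>" and "\<eta> > 0"
  obtains \<epsilon>0 where "\<epsilon>0 > 0" "distortion_bound \<phi> \<eta> \<epsilon>0"
proof -
  obtain T where T: "T > 0" "\<And>\<tau> x. 0 < \<tau> \<Longrightarrow> \<tau> < T \<Longrightarrow> \<phi> \<tau> x \<noteq> x"
    using periods_bounded_below[OF nofix] by blast
  \<comment> \<open>\<open>T / 2\<close> keeps \<open>\<kappa>\<close> below every period.
    \<open>\<eta> / 2\<close> pays for the last, incomplete unit of time: if \<open>n\<close> is the
    integer part of \<open>t\<close>, the errors add up to at most
    \<open>(n + 1) * \<kappa>\<close>, and \<open>n + 1 \<le> 2 * t\<close> because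
    \<open>t \<ge> 1\<close>.\<close>
  define \<kappa> where "\<kappa> = min (T / 2) (\<eta> / 2)"
  have \<kappa>: "0 < \<kappa>" "\<kappa> < T" "2 * \<kappa> \<le> \<eta>" using T(1) assms(2) unfolding \<kappa>_def by auto
  obtain \<gamma> where \<gamma>: "\<gamma> > 0" "\<And>x. \<gamma> \<le> dist (\<phi> \<kappa> x) x"
    using flow_displacement_bounded_below[of \<kappa>] T(2)[OF \<kappa>(1,2)] by blast
  obtain \<epsilon> where \<epsilon>: "\<epsilon> > 0"
    "\<And>x y r. dist x y < \<epsilon> \<Longrightarrow> 0 \<le> r \<Longrightarrow> r \<le> 1 \<Longrightarrow> dist (\<phi> r x) (\<phi> r y) < \<gamma> / 2"
    using flow_equicontinuous[of "\<gamma> / 2"] \<gamma>(1) by auto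
  show thesis
  \<comment> \<open>Closeness at time \<open>s\<close>, carried along by the flow for at most unit
    time, costs \<open>\<gamma> / 2\<close>; closeness at the later time itself costs another
    \<open>\<gamma> / 2\<close>. Together they stay below the displacement
    \<open>\<gamma>\<close>.\<close>
  proof (rule that[of "min \<epsilon> (\<gamma> / 2)"])
    show "min \<epsilon> (\<gamma> / 2) > 0" using \<epsilon>(1) \<gamma>(1) by simp
    show "distortion_bound \<phi> \<eta> (min \<epsilon> (\<gamma> / 2))"
      unfolding distortion_bound_def
    proof (intro allI impI)
      fix x y :: 'a and t :: real and \<alpha>
      assume t: "1 \<le> t" and cont: "continuous_on {0..t} \<alpha>" and "\<alpha> 0 = 0"
        and "\<forall>s\<in>{0..t}. dist (\<phi> (\<alpha> s) x) (\<phi> s y) < min \<epsilon> (\<gamma> / 2)"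
      then have close: "dist (\<phi> (\<alpha> s) x) (\<phi> s y) < min \<epsilon> (\<gamma> / 2)" if "s \<in> {0..t}" for s
        using that by blast
      have step: "\<bar>\<alpha> (s + r) - \<alpha> s - r\<bar> < \<kappa>" if sr: "0 \<le> s" "0 \<le> r" "r \<le> 1" "s + r \<le> t" for s r
      proof (rule ccontr)
        assume "\<not> ?thesis"
        moreover have "continuous_on {0..r} (\<lambda>u. \<bar>\<alpha> (s + u) - \<alpha> s - u\<bar>)"
          by (intro continuous_intros continuous_on_compose2[OF cont]) (use sr in auto)
        \<comment> \<open>The intermediate value theorem catches a defect of exactly
          \<open>\<kappa>\<close>, the one value for which the displacement is controlled.\<close>
        ultimately obtain u where u: "0 \<le> u" "u \<le> r" "\<bar>\<alpha> (s + u) - \<alpha> s - u\<bar> = \<kappa>"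
          using IVT'[of "\<lambda>u. \<bar>\<alpha> (s + u) - \<alpha> s - u\<bar>" 0 \<kappa> r] \<kappa>(1) sr(2) by auto
        have "dist (\<phi> u (\<phi> (\<alpha> s) x)) (\<phi> u (\<phi> s y)) < \<gamma> / 2"
          by (rule \<epsilon>(2)) (use u sr close[of s] in auto)
        then have "dist (\<phi> (\<alpha> s + u) x) (\<phi> (s + u) y) < \<gamma> / 2"
          by (simp add: flow_add)
        moreover have "dist (\<phi> (\<alpha> (s + u)) x) (\<phi> (s + u) y) < \<gamma> / 2"
          using close[of "s + u"] u sr by simp
        ultimately have near: "dist (\<phi> (\<alpha> (s + u)) x) (\<phi> (\<alpha> s + u) x) < \<gamma>"
          by (smt (verit) dist_commute dist_triangle field_sum_of_halves)
        from u(3) consider "\<alpha> (s + u) = (\<alpha> s + u) + \<kappa>" | "\<alpha> s + u = \<alpha> (s + u) + \<kappa>"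
          by linarith
        then show False
        proof cases
          case 1
          then have "\<phi> (\<alpha> (s + u)) x = \<phi> \<kappa> (\<phi> (\<alpha> s + u) x)" by (simp add: flow_add)
          then show False using near \<gamma>(2)[of "\<phi> (\<alpha> s + u) x"] by simp
        next
          case 2
          then have "\<phi> (\<alpha> s + u) x = \<phi> \<kappa> (\<phi> (\<alpha> (s + u)) x)" by (simp add: flow_add)
          then show False using near \<gamma>(2)[of "\<phi> (\<alpha> (s + u)) x"] by (simp add: dist_commute)
        qed
      qed
      have integer: "\<bar>\<alpha> (real n) - real n\<bar> \<le> real n * \<kappa>" if "real n \<le> t" for n
        using that
      proof (induction n)
        case 0
        then show ?case using \<open>\<alpha> 0 = 0\<close> by simp
      next
        case (Suc n)
        then have "\<bar>\<alpha> (real n) - real n\<bar> \<le> real n * \<kappa>" "\<bar>\<alpha> (real n + 1) - \<alpha> (real n) - 1\<bar> < \<kappa>"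
          using step[of "real n" 1] by simp_all
        then show ?case by (simp add: algebra_simps)
      qed
      define n where "n = nat \<lfloor>t\<rfloor>"
      have n: "real n \<le> t" "t \<le> real n + 1" using t unfolding n_def by linarith+
      have "\<bar>\<alpha> (real n) - real n\<bar> \<le> real n * \<kappa>" "\<bar>\<alpha> t - \<alpha> (real n) - (t - real n)\<bar> < \<kappa>"
        using integer[OF n(1)] step[of "real n" "t - real n"] n by simp_all
      then have "\<bar>\<alpha> t - t\<bar> \<le> (real n + 1) * \<kappa>" by (simp add: algebra_simps)
      also have "\<dots> \<le> (2 * t) * \<kappa>" using n(1) t \<kappa>(1) by (intro mult_right_mono) auto
      also have "\<dots> \<le> \<eta> * t" using mult_right_mono[OF \<kappa>(3), of t] t by (simp add: mult_ac)
      finally show "\<bar>\<alpha> t - t\<bar> \<le> \<eta> * t" .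
    qed
  qed
qed

text \<open>The union over all reparametrizations is uncountable, so measurability of the balls is
  obtained through openness. For one fixed \<open>\<alpha>\<close>, the excluded points are the
  projection of a compact set of pairs of a time and a point, hence closed.\<close>

lemma open_rep_ball: "open (rep_ball \<phi> x t \<epsilon>)"
proof -
  have "open {y. \<forall>s\<in>{0..t}. dist (\<phi> (\<alpha> s) x) (\<phi> s y) < \<epsilon>}" if "\<alpha> \<in> Rep {0..t}" for \<alpha>
  proof -
    have \<alpha>: "continuous_on {0..t} \<alpha>"
      using that unfolding Rep_def homeomorphism_def by blast
    define K where "K = {0..t} \<times> (UNIV :: 'a set)"
    define far where "far = K \<inter> (\<lambda>p. dist (\<phi> (\<alpha> (fst p)) x) (\<phi> (fst p) (snd p))) -` {\<epsilon>..}"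
    have K: "compact K" unfolding K_def by (intro compact_Times compact_Icc flow_compact)
    have "continuous_on K (\<lambda>p. dist (\<phi> (\<alpha> (fst p)) x) (\<phi> (fst p) (snd p)))"
      by (intro continuous_intros continuous_on_compose2[OF \<alpha>]) (auto simp: K_def)
    then have "closed far"
      unfolding far_def by (rule continuous_closed_preimage[OF _ compact_imp_closed[OF K] closed_atLeast])
    then have "compact (K \<inter> far)" by (rule compact_Int_closed[OF K])
    then have "compact (snd ` (K \<inter> far))"
      by (intro compact_continuous_image continuous_intros)
    then have "open (- (snd ` (K \<inter> far)))"
      by (simp add: compact_imp_closed open_Compl)
    also have "- (snd ` (K \<inter> far)) = {y. \<forall>s\<in>{0..t}. dist (\<phi> (\<alpha> s) x) (\<phi> s y) < \<epsilon>}"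
      unfolding K_def far_def by (force simp: not_le image_iff)
    finally show ?thesis .
  qed
  moreover have "rep_ball \<phi> x t \<epsilon> =
      (\<Union>\<alpha>\<in>Rep {0..t}. {y. \<forall>s\<in>{0..t}. dist (\<phi> (\<alpha> s) x) (\<phi> s y) < \<epsilon>})"
    unfolding rep_ball_def by blast
  ultimately show ?thesis by auto
qed

end

section \<open>Inverting and composing reparametrizations; approximate metric properties of
  balls\<close>

lemma Rep_subset:
  assumes "\<alpha> \<in> Rep I" "J \<subseteq> I"
  shows "\<alpha> \<in> Rep J"
proof -
  obtain \<beta> where "homeomorphism I (\<alpha> ` I) \<alpha> \<beta>" "\<alpha> 0 = 0"
    using assms(1) unfolding Rep_def by blast
  moreover from homeomorphism_of_subsets[OF this(1) assms(2) subset_refl refl]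
  have "homeomorphism J (\<alpha> ` J) \<alpha> \<beta>" .
  ultimately show ?thesis unfolding Rep_def by blast
qed

lemma rep_ball_mono:
  assumes "t' \<le> t" "\<epsilon> \<le> \<epsilon>'"
  shows "rep_ball \<phi> x t \<epsilon> \<subseteq> rep_ball \<phi> x t' \<epsilon>'"
proof
  fix y assume "y \<in> rep_ball \<phi> x t \<epsilon>"
  then obtain \<alpha> where "\<alpha> \<in> Rep {0..t}" "\<forall>s\<in>{0..t}. dist (\<phi> (\<alpha> s) x) (\<phi> s y) < \<epsilon>"
    unfolding rep_ball_def by blast
  moreover from this(1) have "\<alpha> \<in> Rep {0..t'}"
    by (rule Rep_subset) (use assms in auto)
  ultimately have "\<alpha> \<in> Rep {0..t'}" "\<forall>s\<in>{0..t'}. dist (\<phi> (\<alpha> s) x) (\<phi> s y) < \<epsilon>'"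
    using assms by (auto intro: less_le_trans[OF _ assms(2)])
  then show "y \<in> rep_ball \<phi> x t' \<epsilon>'" unfolding rep_ball_def by blast
qed

text \<open>By the intermediate value theorem the image of \<open>{0..t}\<close> contains everything
  between \<open>\<alpha> 0 = 0\<close> and \<open>\<alpha> t\<close>, so the inverse is defined on
  all of \<open>{0..u}\<close>.\<close>

lemma inverse_in_Rep:
  assumes "homeomorphism {0..t} (\<alpha> ` {0..t}) \<alpha> \<beta>" "\<alpha> 0 = 0" "0 \<le> t" "0 \<le> u" "u \<le> \<alpha> t"
  shows "\<beta> \<in> Rep {0..u}" "\<And>s. s \<in> {0..u} \<Longrightarrow> \<beta> s \<in> {0..t} \<and> \<alpha> (\<beta> s) = s"
proof -
  have cont: "continuous_on {0..t} \<alpha>" using assms(1) by (simp add: homeomorphism_def)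
  have sub: "{0..u} \<subseteq> \<alpha> ` {0..t}"
  proof
    fix v assume "v \<in> {0..u}"
    then show "v \<in> \<alpha> ` {0..t}" using IVT'[of \<alpha> 0 v t] cont assms by (auto simp: image_iff)
  qed
  show "\<beta> s \<in> {0..t} \<and> \<alpha> (\<beta> s) = s" if "s \<in> {0..u}" for s
  proof -
    from sub that obtain r where "r \<in> {0..t}" "s = \<alpha> r" by blast
    then show ?thesis using homeomorphism_apply1[OF assms(1)] by simp
  qed
  have "homeomorphism {0..u} (\<beta> ` {0..u}) \<beta> \<alpha>"
    by (rule homeomorphism_of_subsets[OF homeomorphism_symD[OF assms(1)] sub subset_refl refl])
  moreover have "\<beta> 0 = 0" using homeomorphism_apply1[OF assms(1), of 0] assms by simp
  ultimately show "\<beta> \<in> Rep {0..u}" unfolding Rep_def by blast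
qed

lemma Rep_compose:
  assumes "\<alpha> \<in> Rep I" "\<gamma> \<in> Rep J" "\<gamma> ` J \<subseteq> I"
  shows "\<alpha> \<circ> \<gamma> \<in> Rep J"
proof -
  obtain \<beta> \<delta> where \<beta>: "homeomorphism I (\<alpha> ` I) \<alpha> \<beta>" "\<alpha> 0 = 0"
    and \<delta>: "homeomorphism J (\<gamma> ` J) \<gamma> \<delta>" "\<gamma> 0 = 0"
    using assms(1,2) unfolding Rep_def by blast
  have "homeomorphism (\<gamma> ` J) (\<alpha> ` \<gamma> ` J) \<alpha> \<beta>"
    by (rule homeomorphism_of_subsets[OF \<beta>(1) assms(3) subset_refl refl])
  from homeomorphism_compose[OF \<delta>(1) this]
  have "homeomorphism J ((\<alpha> \<circ> \<gamma>) ` J) (\<alpha> \<circ> \<gamma>) (\<delta> \<circ> \<beta>)" by (simp only: image_comp)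
  moreover have "(\<alpha> \<circ> \<gamma>) 0 = 0" using \<beta>(2) \<delta>(2) by simp
  ultimately show ?thesis unfolding Rep_def by blast
qed

context
  fixes \<phi> :: "real \<Rightarrow> 'a::metric_space \<Rightarrow> 'a" and \<eta> \<epsilon>0 :: real
  assumes \<eta>: "0 < \<eta>" "\<eta> \<le> 1 / 2"
    and distortion: "distortion_bound \<phi> \<eta> \<epsilon>0"
begin

text \<open>Inverting the reparametrization exchanges the two orbits. The time that survives is
  \<open>\<alpha> t\<close>, which the distortion bound keeps above
  \<open>(1 - \<eta>) * t\<close>.\<close>

lemma rep_ball_sym_distorted:
  assumes y: "y \<in> rep_ball \<phi> x t \<epsilon>" and "\<epsilon> \<le> \<epsilon>0" "1 \<le> t"
  shows "x \<in> rep_ball \<phi> y ((1 - \<eta>) * t) \<epsilon>"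
proof -
  obtain \<alpha> \<beta> where \<beta>: "homeomorphism {0..t} (\<alpha> ` {0..t}) \<alpha> \<beta>" and "\<alpha> 0 = 0"
    and close: "\<And>s. s \<in> {0..t} \<Longrightarrow> dist (\<phi> (\<alpha> s) x) (\<phi> s y) < \<epsilon>"
    using y unfolding rep_ball_def Rep_def by blast
  have "continuous_on {0..t} \<alpha>" using \<beta> by (simp add: homeomorphism_def)
  then have "\<bar>\<alpha> t - t\<bar> \<le> \<eta> * t"
    by (rule distortion_boundD[OF distortion assms(3), of \<alpha> x y, OF _ \<open>\<alpha> 0 = 0\<close>])
      (rule less_le_trans[OF close assms(2)])
  then have "(1 - \<eta>) * t \<le> \<alpha> t" by (simp add: algebra_simps)
  then have *: "\<beta> \<in> Rep {0..(1 - \<eta>) * t}"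
    "\<And>s. s \<in> {0..(1 - \<eta>) * t} \<Longrightarrow> \<beta> s \<in> {0..t} \<and> \<alpha> (\<beta> s) = s"
    using inverse_in_Rep[OF \<beta> \<open>\<alpha> 0 = 0\<close>, of "(1 - \<eta>) * t"] \<eta> assms(3) by auto
  have "\<forall>s\<in>{0..(1 - \<eta>) * t}. dist (\<phi> (\<beta> s) y) (\<phi> s x) < \<epsilon>"
    using *(2) close by (metis dist_commute)
  with *(1) show ?thesis unfolding rep_ball_def by blast
qed

text \<open>The composition \<open>\<alpha> \<circ> \<gamma>\<close> makes sense only while
  \<open>\<gamma>\<close> stays inside \<open>{0..t}\<close>. Stopping at
  \<open>u = (1 - \<eta>) * t\<close> ensures this, since
  \<open>\<gamma> u \<le> (1 + \<eta>) * (1 - \<eta>) * t \<le> t\<close>; the assumption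
  \<open>2 \<le> t\<close> gives \<open>1 \<le> u\<close>, from where on the distortion bound
  applies.\<close>

lemma rep_ball_trans_distorted:
  assumes y: "y \<in> rep_ball \<phi> x t \<epsilon>" and z: "z \<in> rep_ball \<phi> y t \<epsilon>'"
    and "\<epsilon>' \<le> \<epsilon>0" "2 \<le> t"
  shows "z \<in> rep_ball \<phi> x ((1 - \<eta>) * t) (\<epsilon> + \<epsilon>')"
proof -
  obtain \<alpha> where \<alpha>: "\<alpha> \<in> Rep {0..t}"
    and \<alpha>_close: "\<And>s. s \<in> {0..t} \<Longrightarrow> dist (\<phi> (\<alpha> s) x) (\<phi> s y) < \<epsilon>"
    using y unfolding rep_ball_def by blast
  obtain \<gamma> where \<gamma>: "\<gamma> \<in> Rep {0..t}"
    and \<gamma>_close: "\<And>s. s \<in> {0..t} \<Longrightarrow> dist (\<phi> (\<gamma> s) y) (\<phi> s z) < \<epsilon>'"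
    using z unfolding rep_ball_def by blast
  define u where "u = (1 - \<eta>) * t"
  have u: "1 \<le> u" "u \<le> t"
    using mult_mono[of "1/2" "1 - \<eta>" 2 t] \<eta> assms(4) unfolding u_def
    by (auto simp: algebra_simps)
  have \<gamma>u: "\<gamma> \<in> Rep {0..u}" using Rep_subset[OF \<gamma>] u by simp
  then have cont: "continuous_on {0..u} \<gamma>" and inj: "inj_on \<gamma> {0..u}" and "\<gamma> 0 = 0"
    unfolding Rep_def homeomorphism_def by (auto intro: inj_on_inverseI)
  have "\<bar>\<gamma> u - u\<bar> \<le> \<eta> * u"
    by (rule distortion_boundD[OF distortion u(1) cont \<open>\<gamma> 0 = 0\<close>, of y z],
        rule less_le_trans[OF \<gamma>_close assms(3)]) (use u in auto)
  moreover have "\<eta> * u \<le> u / 2" using mult_right_mono[OF \<eta>(2), of u] u(1) by simp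
  moreover have "(1 + \<eta>) * u = t - \<eta> * \<eta> * t"
    unfolding u_def by (simp add: algebra_simps)
  moreover have "0 \<le> \<eta> * \<eta> * t" using \<eta> assms(4) by simp
  ultimately have end_u: "0 < \<gamma> u" "\<gamma> u \<le> t"
    using u(1) unfolding distrib_right by linarith+
  \<comment> \<open>A continuous injective map on an interval is monotone, so the values in between
    lie between \<open>\<gamma> 0 = 0\<close> and \<open>\<gamma> u\<close>.\<close>
  have range: "\<gamma> s \<in> {0..t}" if "s \<in> {0..u}" for s
  proof (cases "s = 0 \<or> s = u")
    case True
    then show ?thesis using end_u \<open>\<gamma> 0 = 0\<close> assms(4) by auto
  next
    case False
    then have "0 < s" "s < u" using that by auto
    from continuous_inj_imp_mono[OF this cont inj] show ?thesis
      using end_u \<open>\<gamma> 0 = 0\<close> by auto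
  qed
  have "\<alpha> \<circ> \<gamma> \<in> Rep {0..u}" by (rule Rep_compose[OF \<alpha> \<gamma>u]) (use range in auto)
  moreover have "dist (\<phi> ((\<alpha> \<circ> \<gamma>) s) x) (\<phi> s z) < \<epsilon> + \<epsilon>'" if "s \<in> {0..u}" for s
  proof -
    have "dist (\<phi> (\<alpha> (\<gamma> s)) x) (\<phi> (\<gamma> s) y) < \<epsilon>" using \<alpha>_close range[OF that] .
    moreover have "dist (\<phi> (\<gamma> s) y) (\<phi> s z) < \<epsilon>'" using \<gamma>_close that u(2) by simp
    ultimately show ?thesis using dist_triangle[of "\<phi> (\<alpha> (\<gamma> s)) x" "\<phi> s z" "\<phi> (\<gamma> s) y"] by simp
  qed
  ultimately show ?thesis unfolding rep_ball_def u_def by blast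
qed

end

text \<open>Symmetry and transitivity each cost a factor \<open>1 - \<eta>\<close> in time, and
  \<open>(1 - \<eta>)\<^sup>2 \<ge> 1 - 2 * \<eta> \<ge> c\<close>. Starting from
  \<open>4 \<le> t\<close>, at least time 2 is left for transitivity. The first inclusion recentres
  a ball of a cover at a point of \<open>E\<close>; the second lets a maximal packing cover.\<close>

lemma rep_ball_engulfing:
  assumes "compact_metric_flow \<phi>" "without_fixed_points \<phi>" "c < 1"
  obtains \<epsilon>0 where "\<epsilon>0 > 0"
    "\<And>\<epsilon> t x y z. \<epsilon> \<le> \<epsilon>0 \<Longrightarrow> 4 \<le> t \<Longrightarrow> y \<in> rep_ball \<phi> x t \<epsilon> \<Longrightarrow> z \<in> rep_ball \<phi> x t \<epsilon> \<Longrightarrow>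
       z \<in> rep_ball \<phi> y (c * t) (2 * \<epsilon>)"
    "\<And>\<epsilon> t x y z. \<epsilon> \<le> \<epsilon>0 \<Longrightarrow> 4 \<le> t \<Longrightarrow> z \<in> rep_ball \<phi> x t \<epsilon> \<Longrightarrow> z \<in> rep_ball \<phi> y t \<epsilon> \<Longrightarrow>
       x \<in> rep_ball \<phi> y (c * t) (2 * \<epsilon>)"
proof -
  define \<eta> where "\<eta> = min (1 / 2) ((1 - c) / 2)"
  have \<eta>: "0 < \<eta>" "\<eta> \<le> 1 / 2" "c \<le> 1 - 2 * \<eta>"
    using assms(3) unfolding \<eta>_def by (auto simp: min_def field_simps)
  obtain \<epsilon>0 where "\<epsilon>0 > 0"
    and D: "distortion_bound \<phi> \<eta> \<epsilon>0"
    using reparametrization_distortion[OF assms(1,2) \<eta>(1)] by metis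
  note sym = rep_ball_sym_distorted[OF \<eta>(1,2) D] and trans = rep_ball_trans_distorted[OF \<eta>(1,2) D]
  have time: "2 \<le> (1 - \<eta>) * t" "(1 - \<eta>) * t \<le> t" "c * t \<le> (1 - \<eta>) * ((1 - \<eta>) * t)"
    if "4 \<le> t" for t
  proof -
    show "2 \<le> (1 - \<eta>) * t" using mult_mono[of "1/2" "1 - \<eta>" 4 t] \<eta> that by simp
    show "(1 - \<eta>) * t \<le> t" using \<eta> that by (simp add: algebra_simps)
    have "c \<le> (1 - \<eta>) * (1 - \<eta>)"
      using \<eta>(3) zero_le_square[of \<eta>] by (simp add: algebra_simps del: zero_le_square)
    from mult_right_mono[OF this, of t] that show "c * t \<le> (1 - \<eta>) * ((1 - \<eta>) * t)"
      by (simp add: mult.assoc)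
  qed
  show thesis
  proof (rule that[OF \<open>\<epsilon>0 > 0\<close>])
    fix \<epsilon> t x y z
    assume "\<epsilon> \<le> \<epsilon>0" "4 \<le> t" and y: "y \<in> rep_ball \<phi> x t \<epsilon>" and z: "z \<in> rep_ball \<phi> x t \<epsilon>"
    have "x \<in> rep_ball \<phi> y ((1 - \<eta>) * t) \<epsilon>"
      by (rule sym[OF y \<open>\<epsilon> \<le> \<epsilon>0\<close>]) (use \<open>4 \<le> t\<close> in simp)
    moreover have "z \<in> rep_ball \<phi> x ((1 - \<eta>) * t) \<epsilon>"
      using rep_ball_mono[OF time(2)[OF \<open>4 \<le> t\<close>] order_refl] z by blast
    ultimately have "z \<in> rep_ball \<phi> y ((1 - \<eta>) * ((1 - \<eta>) * t)) (\<epsilon> + \<epsilon>)"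
      by (rule trans[OF _ _ \<open>\<epsilon> \<le> \<epsilon>0\<close> time(1)[OF \<open>4 \<le> t\<close>]])
    then show "z \<in> rep_ball \<phi> y (c * t) (2 * \<epsilon>)"
      by (rule subsetD[OF rep_ball_mono, rotated -1]) (use time(3)[OF \<open>4 \<le> t\<close>] in simp_all)
  next
    fix \<epsilon> t x y z
    assume "\<epsilon> \<le> \<epsilon>0" "4 \<le> t" and x: "z \<in> rep_ball \<phi> x t \<epsilon>" and y: "z \<in> rep_ball \<phi> y t \<epsilon>"
    have "z \<in> rep_ball \<phi> y ((1 - \<eta>) * t) \<epsilon>"
      using rep_ball_mono[OF time(2)[OF \<open>4 \<le> t\<close>] order_refl] y by blast
    moreover have "x \<in> rep_ball \<phi> z ((1 - \<eta>) * t) \<epsilon>"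
      by (rule sym[OF x \<open>\<epsilon> \<le> \<epsilon>0\<close>]) (use \<open>4 \<le> t\<close> in simp)
    ultimately have "x \<in> rep_ball \<phi> y ((1 - \<eta>) * ((1 - \<eta>) * t)) (\<epsilon> + \<epsilon>)"
      by (rule trans[OF _ _ \<open>\<epsilon> \<le> \<epsilon>0\<close> time(1)[OF \<open>4 \<le> t\<close>]])
    then show "x \<in> rep_ball \<phi> y (c * t) (2 * \<epsilon>)"
      by (rule subsetD[OF rep_ball_mono, rotated -1]) (use time(3)[OF \<open>4 \<le> t\<close>] in simp_all)
  qed
qed

section \<open>The limits in the two entropies as suprema\<close>

text \<open>\<open>Lim\<close> says nothing unless the limit exists. Monotonicity in the radius
  provides existence and identifies the value.\<close>

lemma Lim_at_right_antimono:
  fixes f :: "real \<Rightarrow> 'b::{complete_linorder,linorder_topology}"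
  assumes "\<And>a b. 0 < a \<Longrightarrow> a \<le> b \<Longrightarrow> f b \<le> f a"
  shows "Lim (at_right 0) f = (SUP \<epsilon>\<in>{0<..}. f \<epsilon>)"
proof (rule tendsto_Lim)
  show "(f \<longlongrightarrow> (SUP \<epsilon>\<in>{0<..}. f \<epsilon>)) (at_right 0)"
  proof (rule order_tendstoI)
    fix l assume "l < (SUP \<epsilon>\<in>{0<..}. f \<epsilon>)"
    then obtain e where e: "0 < e" "l < f e" by (auto simp: less_SUP_iff)
    show "\<forall>\<^sub>F x in at_right 0. l < f x"
      by (rule eventually_at_rightI[of 0 e], rule less_le_trans[OF e(2) assms]) (use e(1) in auto)
  next
    fix u assume u: "(SUP \<epsilon>\<in>{0<..}. f \<epsilon>) < u"
    show "\<forall>\<^sub>F x in at_right 0. f x < u"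
      by (rule eventually_at_rightI[of 0 1], rule le_less_trans[OF SUP_upper u]) simp_all
  qed
qed simp

lemma bowen_M_N_eps_le:
  fixes I :: "nat set"
  assumes "\<And>i. i \<in> I \<Longrightarrow> real N \<le> t i" "Z \<subseteq> (\<Union>i\<in>I. rep_ball \<phi> (x i) (t i) \<epsilon>)"
  shows "bowen_M_N_eps \<phi> Z s N \<epsilon> \<le> (\<Sum>\<^sub>\<infinity>i\<in>I. ennreal (exp (- s * t i)))"
  unfolding bowen_M_N_eps_def by (rule Inf_lower) (use assms in blast)

lemma bowen_M_N_eps_mono:
  assumes "N \<le> N'" "\<epsilon> \<le> \<epsilon>'"
  shows "bowen_M_N_eps \<phi> Z s N \<epsilon>' \<le> bowen_M_N_eps \<phi> Z s N' \<epsilon>"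
proof -
  have "bowen_M_N_eps \<phi> Z s N \<epsilon>' \<le> (\<Sum>\<^sub>\<infinity>i\<in>I. ennreal (exp (- s * t i)))"
    if "\<forall>i\<in>I. real N' \<le> t i" "Z \<subseteq> (\<Union>i\<in>I. rep_ball \<phi> (x i) (t i) \<epsilon>)"
    for I :: "nat set" and x t
  proof (rule bowen_M_N_eps_le[where x = x])
    show "real N \<le> t i" if "i \<in> I" for i
      using \<open>\<forall>i\<in>I. real N' \<le> t i\<close> that assms(1) by fastforce
    show "Z \<subseteq> (\<Union>i\<in>I. rep_ball \<phi> (x i) (t i) \<epsilon>')"
      using that(2) rep_ball_mono[OF order_refl assms(2), of \<phi>] by blast
  qed
  then show ?thesis
    unfolding bowen_M_N_eps_def[of \<phi> Z s N' \<epsilon>] by (intro Inf_greatest) blast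
qed

text \<open>Larger \<open>N\<close> and smaller \<open>\<epsilon>\<close> leave fewer admissible
  covers, so both limits are suprema, and a supremum in \<open>ennreal\<close> vanishes only if
  every member does.\<close>

lemma bowen_M_eq_0_iff:
  "bowen_M \<phi> Z s = 0 \<longleftrightarrow> (\<forall>N. \<forall>\<epsilon>>0. bowen_M_N_eps \<phi> Z s N \<epsilon> = 0)"
proof -
  have N: "bowen_M_eps \<phi> Z s \<epsilon> = (SUP N. bowen_M_N_eps \<phi> Z s N \<epsilon>)" for \<epsilon>
    unfolding bowen_M_eps_def
    by (intro limI LIMSEQ_SUP incseq_def[THEN iffD2] allI impI bowen_M_N_eps_mono order_refl)
  have "bowen_M \<phi> Z s = (SUP \<epsilon>\<in>{0<..}. bowen_M_eps \<phi> Z s \<epsilon>)"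
    unfolding bowen_M_def
  proof (rule Lim_at_right_antimono)
    fix a b :: real assume "a \<le> b"
    then show "bowen_M_eps \<phi> Z s b \<le> bowen_M_eps \<phi> Z s a"
      unfolding N by (intro SUP_mono) (auto intro: bowen_M_N_eps_mono)
  qed
  then show ?thesis unfolding N bot_ennreal[symmetric] SUP_bot_conv by auto
qed

lemma neg_log_divide:
  assumes "0 < t"
  shows "neg_log p / ereal t = (if p = 0 then \<infinity> else ereal (- ln p / t))"
  using assms unfolding neg_log_def by simp

lemma neg_log_divide_less_iff:
  assumes "0 \<le> p" "0 < t"
  shows "neg_log p / ereal t < ereal r \<longleftrightarrow> exp (- r * t) < p"
proof (cases "p = 0")
  case False
  then have "p > 0" using assms(1) by simp
  have "exp (- r * t) < p \<longleftrightarrow> - r * t < ln p"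
    by (metis \<open>p > 0\<close> exp_less_cancel_iff exp_ln)
  then show ?thesis using False assms(2) by (auto simp: neg_log_divide field_simps)
qed (use assms in \<open>simp add: neg_log_divide\<close>)

lemma less_neg_log_divide_iff:
  assumes "0 \<le> p" "0 < t"
  shows "ereal r < neg_log p / ereal t \<longleftrightarrow> p < exp (- r * t)"
proof (cases "p = 0")
  case False
  then have "p > 0" using assms(1) by simp
  have "p < exp (- r * t) \<longleftrightarrow> ln p < - r * t"
    by (metis \<open>p > 0\<close> exp_less_cancel_iff exp_ln)
  then show ?thesis using False assms(2) by (auto simp: neg_log_divide field_simps)
qed (use assms in \<open>simp add: neg_log_divide\<close>)

lemma neg_log_antimono:
  assumes "0 \<le> p" "p \<le> q"
  shows "neg_log q \<le> neg_log p"
  using assms unfolding neg_log_def by auto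

lemma lower_local_entropy_eq_SUP:
  assumes "compact_metric_flow \<phi>" "prob_space \<mu>" "sets \<mu> = sets borel"
  shows "lower_local_entropy \<phi> \<mu> x =
    (SUP \<epsilon>\<in>{0<..}. Liminf at_top (\<lambda>t. neg_log (measure \<mu> (rep_ball \<phi> x t \<epsilon>)) / ereal t))"
  unfolding lower_local_entropy_def
proof (rule Lim_at_right_antimono)
  interpret prob_space \<mu> by fact
  fix a b :: real assume "0 < a" "a \<le> b"
  have le: "neg_log (measure \<mu> (rep_ball \<phi> x t b)) \<le> neg_log (measure \<mu> (rep_ball \<phi> x t a))" for t
    by (intro neg_log_antimono finite_measure_mono rep_ball_mono)
      (use assms \<open>a \<le> b\<close> in \<open>auto intro: borel_open open_rep_ball\<close>)
  show "Liminf at_top (\<lambda>t. neg_log (measure \<mu> (rep_ball \<phi> x t b)) / ereal t)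
      \<le> Liminf at_top (\<lambda>t. neg_log (measure \<mu> (rep_ball \<phi> x t a)) / ereal t)"
    by (rule Liminf_mono, rule eventually_mono[OF eventually_gt_at_top[of 0]])
      (use le in \<open>auto intro: ereal_divide_right_mono\<close>)
qed

text \<open>A small entropy yields large balls at every radius, but only at some arbitrarily late
  times; a large entropy yields small balls at all late times, but only at some radius. Hence the
  upper bound must sort points by time, the lower bound by radius and starting time.\<close>

lemma lower_local_entropy_lessD:
  assumes "compact_metric_flow \<phi>" "prob_space \<mu>" "sets \<mu> = sets borel"
    and "lower_local_entropy \<phi> \<mu> x < ereal r" "0 < \<epsilon>"
  shows "\<exists>t\<ge>T. exp (- r * t) < measure \<mu> (rep_ball \<phi> x t \<epsilon>)"
proof (rule ccontr)
  assume "\<not> ?thesis"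
  then have le: "measure \<mu> (rep_ball \<phi> x t \<epsilon>) \<le> exp (- r * t)" if "t \<ge> T" for t
    using that by (meson not_le)
  have "ereal r \<le> Liminf at_top (\<lambda>t. neg_log (measure \<mu> (rep_ball \<phi> x t \<epsilon>)) / ereal t)"
  proof (rule Liminf_bounded, rule eventually_mono[OF eventually_ge_at_top[of "max T 1"]])
    fix t assume "max T 1 \<le> t"
    then have "\<not> neg_log (measure \<mu> (rep_ball \<phi> x t \<epsilon>)) / ereal t < ereal r"
      using neg_log_divide_less_iff[of "measure \<mu> (rep_ball \<phi> x t \<epsilon>)" t r] le[of t] by simp
    then show "ereal r \<le> neg_log (measure \<mu> (rep_ball \<phi> x t \<epsilon>)) / ereal t" by simp
  qed
  also have "\<dots> \<le> lower_local_entropy \<phi> \<mu> x"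
    unfolding lower_local_entropy_eq_SUP[OF assms(1-3)] by (rule SUP_upper) (use assms(5) in simp)
  finally show False using assms(4) by simp
qed

lemma less_lower_local_entropyD:
  assumes "compact_metric_flow \<phi>" "prob_space \<mu>" "sets \<mu> = sets borel"
    and "ereal r < lower_local_entropy \<phi> \<mu> x"
  obtains \<epsilon> T where "0 < \<epsilon>" "\<And>t. t \<ge> T \<Longrightarrow> measure \<mu> (rep_ball \<phi> x t \<epsilon>) < exp (- r * t)"
proof -
  obtain \<epsilon> where \<epsilon>: "0 < \<epsilon>"
    "ereal r < Liminf at_top (\<lambda>t. neg_log (measure \<mu> (rep_ball \<phi> x t \<epsilon>)) / ereal t)"
    using assms(4) unfolding lower_local_entropy_eq_SUP[OF assms(1-3)] by (auto simp: less_SUP_iff)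
  then have "\<forall>\<^sub>F t in at_top. ereal r < neg_log (measure \<mu> (rep_ball \<phi> x t \<epsilon>)) / ereal t"
    by (intro less_LiminfD)
  then obtain T where "\<And>t. t \<ge> T \<Longrightarrow> ereal r < neg_log (measure \<mu> (rep_ball \<phi> x t \<epsilon>)) / ereal t"
    unfolding eventually_at_top_linorder by blast
  then have "measure \<mu> (rep_ball \<phi> x t \<epsilon>) < exp (- r * t)" if "t \<ge> max T 1" for t
    using less_neg_log_divide_iff[of "measure \<mu> (rep_ball \<phi> x t \<epsilon>)" t r] that by simp
  then show thesis by (rule that[OF \<epsilon>(1)])
qed

section \<open>Packing and null sets\<close>

text \<open>Disjoint sets of probability at least \<open>c\<close> number at most
  \<open>1 / c\<close>, so a disjoint family of greatest size exists; a set missing all its members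
  could be appended.\<close>

lemma (in prob_space) maximal_packing:
  assumes meas: "\<And>x. x \<in> A \<Longrightarrow> B x \<in> events" and "0 < c" and large: "\<And>x. x \<in> A \<Longrightarrow> c \<le> prob (B x)"
  obtains k :: nat and f where "real k * c \<le> 1" "\<And>j. j < k \<Longrightarrow> f j \<in> A"
    "\<And>x. x \<in> A \<Longrightarrow> \<exists>j<k. B x \<inter> B (f j) \<noteq> {}"
proof -
  define P where
    "P k \<longleftrightarrow> (\<exists>f. (\<forall>j<k. f j \<in> A) \<and> disjoint_family_on (\<lambda>j. B (f j)) {..<k})" for k :: nat
  have bound: "real k * c \<le> 1" if "P k" for k
  proof -
    obtain f where f: "\<forall>j<k. f j \<in> A" "disjoint_family_on (\<lambda>j. B (f j)) {..<k}"
      using \<open>P k\<close> unfolding P_def by blast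
    have "real k * c \<le> (\<Sum>j<k. prob (B (f j)))"
      using sum_mono[of "{..<k}" "\<lambda>_. c"] large f(1) by simp
    also have "\<dots> = prob (\<Union>j<k. B (f j))"
      by (rule finite_measure_finite_Union[symmetric]) (use f meas in auto)
    finally show ?thesis using prob_le_1 by (rule order_trans)
  qed
  have "P 0" unfolding P_def by (auto simp: disjoint_family_on_def)
  moreover have "\<forall>k. P k \<longrightarrow> k \<le> nat \<lceil>1 / c\<rceil>"
  proof (intro allI impI)
    fix k assume "P k"
    from bound[OF this] \<open>0 < c\<close> have "real k \<le> 1 / c" by (simp add: field_simps)
    then show "k \<le> nat \<lceil>1 / c\<rceil>" by linarith
  qed
  ultimately have "\<exists>k. P k \<and> (\<forall>k'. P k' \<longrightarrow> k' \<le> k)" by (rule Nat.ex_has_greatest_nat)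
  then obtain k where k: "P k" "\<And>k'. P k' \<Longrightarrow> k' \<le> k" by blast
  then obtain f where f: "\<forall>j<k. f j \<in> A" "disjoint_family_on (\<lambda>j. B (f j)) {..<k}"
    unfolding P_def by blast
  have "\<exists>j<k. B x \<inter> B (f j) \<noteq> {}" if "x \<in> A" for x
  proof (rule ccontr)
    assume "\<not> ?thesis"
    then have new: "B x \<inter> B (f j) = {}" "B (f j) \<inter> B x = {}" if "j < k" for j
      using that by (auto simp: Int_commute)
    have "disjoint_family_on (\<lambda>j. B ((f(k := x)) j)) {..<Suc k}"
      unfolding disjoint_family_on_def
    proof (intro ballI impI)
      fix i j assume "i \<in> {..<Suc k}" "j \<in> {..<Suc k}" "i \<noteq> j"
      then show "B ((f(k := x)) i) \<inter> B ((f(k := x)) j) = {}"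
        using new[of i] new[of j] disjoint_family_onD[OF f(2), of i j]
        by (cases "i = k"; cases "j = k") simp_all
    qed
    moreover have "\<forall>j<Suc k. (f(k := x)) j \<in> A" using f(1) that by (simp add: less_Suc_eq)
    ultimately have "P (Suc k)" unfolding P_def by (intro exI[of _ "f(k := x)"] conjI)
    with k(2) show False by fastforce
  qed
  then show thesis using f(1) by (intro that[OF bound[OF k(1)], of f]) simp_all
qed

lemma emeasure_UN_le_infsum:
  fixes I :: "nat set"
  assumes "\<And>i. i \<in> I \<Longrightarrow> A i \<in> sets M"
  shows "emeasure M (\<Union>i\<in>I. A i) \<le> (\<Sum>\<^sub>\<infinity>i\<in>I. emeasure M (A i))"
proof -
  define B where "B i = (if i \<in> I then A i else {})" for i
  have "(\<Union>i\<in>I. A i) = (\<Union>i. B i)" by (auto simp: B_def)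
  then have "emeasure M (\<Union>i\<in>I. A i) \<le> (\<Sum>i. emeasure M (B i))"
    using emeasure_subadditive_countably[of B M] assms by (auto simp: B_def)
  also have "\<dots> = (\<Sum>\<^sub>\<infinity>i. emeasure M (B i))"
    by (rule sums_unique[symmetric], rule has_sum_imp_sums, rule has_sum_infsum,
        rule nonneg_summable_on_complete) simp
  also have "\<dots> = (\<Sum>\<^sub>\<infinity>i\<in>I. emeasure M (A i))"
    by (rule infsum_cong_neutral) (auto simp: B_def)
  finally show ?thesis .
qed

text \<open>Expresses outer measure zero without measurability of \<open>A\<close>. It will be
  applied to sets cut out by uncountably many conditions, one for each real time.\<close>

lemma null_superset_exists:
  assumes "\<And>\<delta>. 0 < \<delta> \<Longrightarrow> \<exists>G\<in>sets M. A \<subseteq> G \<and> emeasure M G \<le> ennreal \<delta>"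
  shows "\<exists>N\<in>null_sets M. A \<subseteq> N"
proof -
  have "\<forall>k. \<exists>G\<in>sets M. A \<subseteq> G \<and> emeasure M G \<le> ennreal (inverse (real (Suc k)))"
    using assms by simp
  then obtain G where G: "\<And>k. G k \<in> sets M" "\<And>k. A \<subseteq> G k"
    "\<And>k. emeasure M (G k) \<le> ennreal (inverse (real (Suc k)))"
    by metis
  have "emeasure M (\<Inter>k. G k) \<le> ennreal (inverse (real (Suc k)))" for k
    by (rule order_trans[OF emeasure_mono G(3)]) (use G(1) in auto)
  moreover have "(\<lambda>k. ennreal (inverse (real (Suc k)))) \<longlonglongrightarrow> 0"
    using tendsto_ennrealI[OF LIMSEQ_inverse_real_of_nat] by simp
  ultimately have "emeasure M (\<Inter>k. G k) \<le> 0"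
    by (intro LIMSEQ_le_const[of _ 0]) auto
  then have "(\<Inter>k. G k) \<in> null_sets M"
    using G(1) by (intro null_setsI) auto
  with G(2) show ?thesis by blast
qed

section \<open>Upper bound for the Bowen entropy\<close>

lemma sum_geometric_le:
  fixes q :: real
  assumes "0 \<le> q" "q < 1"
  shows "(\<Sum>n = m..<m'. q ^ n) \<le> q ^ m / (1 - q)"
proof (cases "m \<le> m'")
  case True
  then have "(1 - q) * (\<Sum>n = m..<m'. q ^ n) = q ^ m - q ^ m'"
  proof (induction m' rule: dec_induct)
    case (step n)
    then have "(1 - q) * (\<Sum>i = m..<Suc n. q ^ i) = q ^ m - q ^ n + (1 - q) * q ^ n"
      by (simp add: distrib_left)
    then show ?case by (simp add: algebra_simps)
  qed simp
  also have "\<dots> \<le> q ^ m" using assms by simp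
  finally show ?thesis using assms by (simp add: field_simps)
qed (use assms in simp)

text \<open>At the integer time \<open>n\<close>, a maximal disjoint family of balls of measure at least
  \<open>exp (- s\<^sub>1 (n + 1))\<close> has at most \<open>exp (s\<^sub>1 (n + 1))\<close> members, and the doubled balls of time
  \<open>c n\<close> around the same centres cover. Disjointness between different times is not needed, since
  the cost \<open>exp (- s' c n)\<close> with \<open>s' c > s\<^sub>1\<close> makes the sum over \<open>n\<close> converge.\<close>

lemma bowen_M_eq_0_if_lower_local_entropy_le:
  assumes flow: "compact_metric_flow \<phi>" and nofix: "without_fixed_points \<phi>"
    and prob: "prob_space \<mu>" and sets: "sets \<mu> = sets borel"
    and s: "0 < s" "s < s'" and E: "\<And>x. x \<in> E \<Longrightarrow> lower_local_entropy \<phi> \<mu> x \<le> ereal s"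
  shows "bowen_M \<phi> E s' = 0"
  unfolding bowen_M_eq_0_iff
proof (intro allI impI)
  fix N :: nat and \<epsilon> :: real assume "0 < \<epsilon>"
  interpret prob_space \<mu> by fact
  \<comment> \<open>Three gaps are needed: \<open>s < s1\<close> yields balls of measure above
    \<open>exp (- s1 * u)\<close>, \<open>s1 < s2\<close> makes the geometric series converge, and
    \<open>s2 < s'\<close> allows \<open>c = s2 / s' < 1\<close>, so that balls of time
    \<open>c * n\<close> cost exactly \<open>exp (- s2 * n)\<close>.\<close>
  define s1 where "s1 = (s + s') / 2"
  define s2 where "s2 = (s1 + s') / 2"
  define c where "c = s2 / s'"
  have s12: "s < s1" "s1 < s2" "s2 < s'" using s(2) unfolding s1_def s2_def by (auto simp: field_simps)
  then have c: "0 < c" "c < 1" "s' * c = s2" using s unfolding c_def by auto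
  obtain \<epsilon>0 where "\<epsilon>0 > 0" and engulf:
    "\<And>e t x y z. e \<le> \<epsilon>0 \<Longrightarrow> 4 \<le> t \<Longrightarrow> z \<in> rep_ball \<phi> x t e \<Longrightarrow> z \<in> rep_ball \<phi> y t e \<Longrightarrow>
       x \<in> rep_ball \<phi> y (c * t) (2 * e)"
    using rep_ball_engulfing[OF flow nofix c(2)] by metis
  define e where "e = min \<epsilon>0 (\<epsilon> / 2)"
  have e: "0 < e" "e \<le> \<epsilon>0" "2 * e \<le> \<epsilon>" using \<open>\<epsilon>0 > 0\<close> \<open>0 < \<epsilon>\<close> unfolding e_def by auto
  have meas: "rep_ball \<phi> x t r \<in> events" for x t r
    unfolding sets by (rule borel_open[OF open_rep_ball[OF flow]])
  \<comment> \<open>The time \<open>u\<close> at which a ball is large is rounded down to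
    \<open>n\<close>. This only enlarges the ball, while \<open>u \<le> n + 1\<close> accounts for
    the exponent.\<close>
  define A where "A n = {x \<in> E. exp (- s1 * (real n + 1)) \<le> prob (rep_ball \<phi> x (real n) e)}" for n
  have "\<forall>n. \<exists>k f. real k * exp (- s1 * (real n + 1)) \<le> 1 \<and>
      (\<forall>x\<in>A n. \<exists>j<k. rep_ball \<phi> x (real n) e \<inter> rep_ball \<phi> (f j) (real n) e \<noteq> {})"
  proof
    fix n
    show "\<exists>k f. real k * exp (- s1 * (real n + 1)) \<le> 1 \<and>
      (\<forall>x\<in>A n. \<exists>j<k. rep_ball \<phi> x (real n) e \<inter> rep_ball \<phi> (f j) (real n) e \<noteq> {})"
      by (rule maximal_packing[of "A n" "\<lambda>x. rep_ball \<phi> x (real n) e" "exp (- s1 * (real n + 1))",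
            OF meas exp_gt_zero]) (simp add: A_def, blast)
  qed
  then obtain k :: "nat \<Rightarrow> nat" and f where
    k: "\<And>n. real (k n) * exp (- s1 * (real n + 1)) \<le> 1" and
    f: "\<And>n x. x \<in> A n \<Longrightarrow>
       \<exists>j<k n. rep_ball \<phi> x (real n) e \<inter> rep_ball \<phi> (f n j) (real n) e \<noteq> {}"
    by metis
  define q where "q = exp (- (s2 - s1))"
  have q: "0 < q" "q < 1" using s12 unfolding q_def by auto
  have cost: "real (k n) * exp (- s2 * real n) \<le> exp s1 * q ^ n" for n
  proof -
    have "real (k n) \<le> exp (s1 * (real n + 1))"
      using k[of n] by (simp add: exp_minus pos_divide_le_eq flip: divide_inverse)
    then have "real (k n) * exp (- s2 * real n) \<le> exp (s1 * (real n + 1)) * exp (- s2 * real n)"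
      by (rule mult_right_mono) simp
    also have "\<dots> = exp s1 * q ^ n"
      unfolding q_def by (simp add: exp_of_nat_mult[symmetric] exp_add[symmetric] algebra_simps)
    finally show ?thesis .
  qed
  have bound: "bowen_M_N_eps \<phi> E s' N \<epsilon> \<le> ennreal (exp s1 * (q ^ N0 / (1 - q)))"
    if N0: "4 \<le> N0" "real N \<le> c * real N0" for N0
  proof -
    \<comment> \<open>Covers are indexed by naturals, so the ball around the \<open>j\<close>-th
      centre at time \<open>n\<close> is stored under the code of \<open>(n, j)\<close>.\<close>
    define I where "I = prod_encode ` (SIGMA n:{N0..}. {..<k n})"
    define t where "t i = c * real (fst (prod_decode i))" for i
    define x where "x i = case_prod f (prod_decode i)" for i
    have "bowen_M_N_eps \<phi> E s' N \<epsilon> \<le> (\<Sum>\<^sub>\<infinity>i\<in>I. ennreal (exp (- s' * t i)))"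
    proof (rule bowen_M_N_eps_le[where x = x])
      fix i assume "i \<in> I"
      then have "N0 \<le> fst (prod_decode i)" unfolding I_def by auto
      then have "c * real N0 \<le> t i" unfolding t_def using c(1) by simp
      with N0(2) show "real N \<le> t i" by simp
    next
      show "E \<subseteq> (\<Union>i\<in>I. rep_ball \<phi> (x i) (t i) \<epsilon>)"
      proof
        fix y assume "y \<in> E"
        have "lower_local_entropy \<phi> \<mu> y < ereal s1"
          by (rule le_less_trans[OF E[OF \<open>y \<in> E\<close>]]) (use s12 in simp)
        then obtain u where u: "u \<ge> real N0" "exp (- s1 * u) < prob (rep_ball \<phi> y u e)"
          using lower_local_entropy_lessD[OF flow prob sets _ e(1)] by blast
        define n where "n = nat \<lfloor>u\<rfloor>"
        have n: "real n \<le> u" "u \<le> real n + 1" "N0 \<le> n" using u(1) unfolding n_def by linarith+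
        have "exp (- s1 * (real n + 1)) \<le> exp (- s1 * u)" using n s12 s by simp
        also have "\<dots> \<le> prob (rep_ball \<phi> y u e)" using u(2) by simp
        also have "\<dots> \<le> prob (rep_ball \<phi> y (real n) e)"
          by (rule finite_measure_mono[OF rep_ball_mono[OF n(1) order_refl] meas])
        finally have "y \<in> A n" using \<open>y \<in> E\<close> unfolding A_def by simp
        then obtain j z where j: "j < k n"
          and z: "z \<in> rep_ball \<phi> y (real n) e" "z \<in> rep_ball \<phi> (f n j) (real n) e"
          using f by blast
        have "4 \<le> real n" using n(3) N0(1) by simp
        have "y \<in> rep_ball \<phi> (f n j) (c * real n) (2 * e)"
          by (rule engulf[OF e(2) \<open>4 \<le> real n\<close> z])
        then have "y \<in> rep_ball \<phi> (f n j) (c * real n) \<epsilon>"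
          by (rule subsetD[OF rep_ball_mono[OF order_refl e(3)]])
        moreover have "prod_encode (n, j) \<in> I" unfolding I_def using n(3) j by auto
        ultimately show "y \<in> (\<Union>i\<in>I. rep_ball \<phi> (x i) (t i) \<epsilon>)"
          by (intro UN_I[of "prod_encode (n, j)"]) (simp_all add: x_def t_def)
      qed
    qed
    also have "\<dots> \<le> ennreal (exp s1 * (q ^ N0 / (1 - q)))"
    proof (rule infsum_le_finite_sums)
      show "(\<lambda>i. ennreal (exp (- s' * t i))) summable_on I"
        by (rule nonneg_summable_on_complete) simp
      fix F assume F: "finite F" "F \<subseteq> I"
      \<comment> \<open>The code of a pair is at least its first component, so a finite set of codes
        involves only times below \<open>M\<close>; inserting 0 takes care of an empty
        \<open>F\<close>.\<close>
      define M where "M = Suc (Max (insert 0 F))"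
      define J where "J = (SIGMA n:{N0..<M}. {..<k n})"
      have "F \<subseteq> prod_encode ` J"
      proof
        fix i assume "i \<in> F"
        then obtain n j where nj: "i = prod_encode (n, j)" "N0 \<le> n" "j < k n"
          using F(2) unfolding I_def by auto
        have "i \<le> Max (insert 0 F)" using \<open>i \<in> F\<close> F(1) by simp
        with le_prod_encode_1[of n j] nj(1) have "n < M" unfolding M_def by simp
        with nj show "i \<in> prod_encode ` J" unfolding J_def by auto
      qed
      then have "(\<Sum>i\<in>F. exp (- s' * t i)) \<le> (\<Sum>i\<in>prod_encode ` J. exp (- s' * t i))"
        by (intro sum_mono2) (auto simp: J_def)
      also have "\<dots> = (\<Sum>p\<in>J. exp (- s' * t (prod_encode p)))"
        by (subst sum.reindex) (simp_all add: inj_prod_encode)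
      also have "\<dots> = (\<Sum>(n, j)\<in>J. exp (- s2 * real n))"
        by (rule sum.cong) (auto simp: t_def c(3)[symmetric])
      also have "\<dots> = (\<Sum>n = N0..<M. \<Sum>j<k n. exp (- s2 * real n))"
        unfolding J_def by (rule sum.Sigma[symmetric]) auto
      also have "\<dots> \<le> (\<Sum>n = N0..<M. exp s1 * q ^ n)"
        by (rule sum_mono) (use cost in simp)
      also have "\<dots> \<le> exp s1 * (q ^ N0 / (1 - q))"
        unfolding sum_distrib_left[symmetric]
        by (rule mult_left_mono[OF sum_geometric_le]) (use q in auto)
      finally have "ennreal (\<Sum>i\<in>F. exp (- s' * t i)) \<le> ennreal (exp s1 * (q ^ N0 / (1 - q)))"
        by (rule ennreal_leI)
      then show "(\<Sum>i\<in>F. ennreal (exp (- s' * t i))) \<le> ennreal (exp s1 * (q ^ N0 / (1 - q)))"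
        by simp
    qed
    finally show ?thesis .
  qed
  \<comment> \<open>\<open>N\<close> and \<open>\<epsilon>\<close> are fixed, but the first time
    \<open>N0\<close> used in the cover is free; letting it grow makes the geometric tail
    vanish.\<close>
  have lim: "(\<lambda>N0. ennreal (exp s1 * (q ^ N0 / (1 - q)))) \<longlonglongrightarrow> ennreal (exp s1 * (0 / (1 - q)))"
    using q by (intro tendsto_ennrealI tendsto_intros LIMSEQ_realpow_zero) auto
  have large: "bowen_M_N_eps \<phi> E s' N \<epsilon> \<le> ennreal (exp s1 * (q ^ N0 / (1 - q)))"
    if "N0 \<ge> max 4 (nat \<lceil>real N / c\<rceil>)" for N0
  proof (rule bound)
    show "4 \<le> N0" using that by simp
    have "real N / c \<le> real N0" using that by linarith
    then show "real N \<le> c * real N0" using c(1) by (simp add: field_simps)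
  qed
  have "bowen_M_N_eps \<phi> E s' N \<epsilon> \<le> ennreal (exp s1 * (0 / (1 - q)))"
    by (rule LIMSEQ_le_const[OF lim]) (intro exI allI impI, rule large)
  then show "bowen_M_N_eps \<phi> E s' N \<epsilon> = 0" by simp
qed

section \<open>Lower bound for the Bowen entropy\<close>

text \<open>This is the lower bound in contrapositive form. \<open>E\<close> is exhausted by strata
  on which balls are small uniformly in radius and starting time. On one stratum each useful ball of
  a cover has measure at most its cost, so cheap covers force outer measure zero.\<close>

lemma measure_eq_0_if_lower_local_entropy_ge:
  assumes flow: "compact_metric_flow \<phi>" and nofix: "without_fixed_points \<phi>"
    and prob: "prob_space \<mu>" and sets: "sets \<mu> = sets borel"
    and s: "0 \<le> s'" "s' < s" and E: "\<And>x. x \<in> E \<Longrightarrow> ereal s \<le> lower_local_entropy \<phi> \<mu> x"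
    and M: "bowen_M \<phi> E s' = 0"
  shows "measure \<mu> E = 0"
proof -
  interpret prob_space \<mu> by fact
  define s1 where "s1 = (s' + s) / 2"
  have s1: "s' < s1" "s1 < s" using s(2) unfolding s1_def by (auto simp: field_simps)
  \<comment> \<open>The bound \<open>s' / s1\<close> makes \<open>exp (- s1 * c * t)\<close> at most
    the cost \<open>exp (- s' * t)\<close>; the bound \<open>1 / 2\<close> keeps the shortened time
    at least \<open>t / 2\<close>, whatever \<open>s'\<close> is.\<close>
  define c where "c = max (1 / 2) (s' / s1)"
  have c: "1 / 2 \<le> c" "c < 1" "s' \<le> s1 * c"
    using s1 s(1) unfolding c_def by (auto simp: field_simps max_def)
  obtain \<epsilon>0 where "\<epsilon>0 > 0" and engulf:
    "\<And>e t x y z. e \<le> \<epsilon>0 \<Longrightarrow> 4 \<le> t \<Longrightarrow> y \<in> rep_ball \<phi> x t e \<Longrightarrow> z \<in> rep_ball \<phi> x t e \<Longrightarrow>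
       z \<in> rep_ball \<phi> y (c * t) (2 * e)"
    using rep_ball_engulfing[OF flow nofix c(2)] by metis
  have meas: "rep_ball \<phi> x t r \<in> events" for x t r
    unfolding sets by (rule borel_open[OF open_rep_ball[OF flow]])
  \<comment> \<open>One index governs both the radius and the starting time: the condition weakens
    as \<open>m\<close> grows, so every pair of a radius and a time threshold is dominated by some
    \<open>m\<close>.\<close>
  define A where
    "A m = {x \<in> E. \<forall>t\<ge>real m. prob (rep_ball \<phi> x t (inverse (real (Suc m)))) < exp (- s1 * t)}" for m
  have A_null: "\<exists>N\<in>null_sets \<mu>. A m \<subseteq> N" for m
  proof (rule null_superset_exists)
    fix \<delta> :: real assume "0 < \<delta>"
    define e where "e = min \<epsilon>0 (inverse (real (Suc m)) / 2)"
    have e: "0 < e" "e \<le> \<epsilon>0" "2 * e \<le> inverse (real (Suc m))"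
      using \<open>\<epsilon>0 > 0\<close> unfolding e_def by auto
    \<comment> \<open>Time 4 is required for engulfing; \<open>2 * m\<close> ensures that half of
      the time still reaches the threshold \<open>m\<close> of the stratum.\<close>
    define N where "N = max 4 (2 * m)"
    have "bowen_M_N_eps \<phi> E s' N e < ennreal \<delta>"
      using M e(1) \<open>0 < \<delta>\<close> unfolding bowen_M_eq_0_iff by simp
    then obtain I :: "nat set" and x t where
      small: "(\<Sum>\<^sub>\<infinity>i\<in>I. ennreal (exp (- s' * t i))) < ennreal \<delta>" and
      t: "\<forall>i\<in>I. real N \<le> t i" and cover: "E \<subseteq> (\<Union>i\<in>I. rep_ball \<phi> (x i) (t i) e)"
      unfolding bowen_M_N_eps_def Inf_less_iff by blast
    \<comment> \<open>A ball that misses \<open>A m\<close> has no point at which its measure could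
      be estimated, and it does not help to cover \<open>A m\<close>.\<close>
    define J where "J = {i \<in> I. rep_ball \<phi> (x i) (t i) e \<inter> A m \<noteq> {}}"
    have ball_le: "emeasure \<mu> (rep_ball \<phi> (x i) (t i) e) \<le> ennreal (exp (- s' * t i))" if "i \<in> J" for i
    proof -
      obtain y where y: "y \<in> rep_ball \<phi> (x i) (t i) e" "y \<in> A m"
        using \<open>i \<in> J\<close> unfolding J_def by blast
      have "real N \<le> t i" using \<open>i \<in> J\<close> t unfolding J_def by blast
      then have ti: "4 \<le> t i" "2 * real m \<le> t i" unfolding N_def by auto
      have "t i / 2 \<le> c * t i" using mult_right_mono[OF c(1), of "t i"] ti(1) by simp
      with ti have cti: "real m \<le> c * t i" by linarith
      have "rep_ball \<phi> (x i) (t i) e \<subseteq> rep_ball \<phi> y (c * t i) (2 * e)"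
        using engulf[OF e(2) ti(1) y(1)] by blast
      also have "\<dots> \<subseteq> rep_ball \<phi> y (c * t i) (inverse (real (Suc m)))"
        by (rule rep_ball_mono[OF order_refl e(3)])
      finally have "prob (rep_ball \<phi> (x i) (t i) e)
          \<le> prob (rep_ball \<phi> y (c * t i) (inverse (real (Suc m))))"
        by (rule finite_measure_mono[OF _ meas])
      also have "\<dots> \<le> exp (- s1 * (c * t i))"
        using y(2) cti unfolding A_def by (auto intro: less_imp_le)
      also have "\<dots> \<le> exp (- s' * t i)"
        using mult_right_mono[OF c(3), of "t i"] ti(1) by (simp add: mult.assoc)
      finally show ?thesis by (simp add: emeasure_eq_measure)
    qed
    have "emeasure \<mu> (\<Union>i\<in>J. rep_ball \<phi> (x i) (t i) e)
        \<le> (\<Sum>\<^sub>\<infinity>i\<in>J. emeasure \<mu> (rep_ball \<phi> (x i) (t i) e))"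
      by (rule emeasure_UN_le_infsum) (rule meas)
    also have "\<dots> \<le> (\<Sum>\<^sub>\<infinity>i\<in>I. ennreal (exp (- s' * t i)))"
      by (rule infsum_mono_neutral)
        (use ball_le in \<open>auto intro!: nonneg_summable_on_complete simp: J_def\<close>)
    also have "\<dots> \<le> ennreal \<delta>" using small by simp
    finally have "emeasure \<mu> (\<Union>i\<in>J. rep_ball \<phi> (x i) (t i) e) \<le> ennreal \<delta>" .
    moreover have "A m \<subseteq> (\<Union>i\<in>J. rep_ball \<phi> (x i) (t i) e)"
    proof
      fix y assume "y \<in> A m"
      then have "y \<in> E" unfolding A_def by simp
      with cover obtain i where "i \<in> I" "y \<in> rep_ball \<phi> (x i) (t i) e" by blast
      with \<open>y \<in> A m\<close> show "y \<in> (\<Union>i\<in>J. rep_ball \<phi> (x i) (t i) e)" unfolding J_def by blast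
    qed
    moreover have "(\<Union>i\<in>J. rep_ball \<phi> (x i) (t i) e) \<in> events"
      by (rule sets.countable_UN') (auto intro: meas)
    ultimately show "\<exists>G\<in>events. A m \<subseteq> G \<and> emeasure \<mu> G \<le> ennreal \<delta>" by blast
  qed
  then obtain N where N: "\<And>m. N m \<in> null_sets \<mu>" "\<And>m. A m \<subseteq> N m" by metis
  have "E \<subseteq> (\<Union>m. N m)"
  proof
    fix x assume "x \<in> E"
    have "ereal s1 < lower_local_entropy \<phi> \<mu> x"
      by (rule less_le_trans[OF _ E[OF \<open>x \<in> E\<close>]]) (use s1 in simp)
    then obtain \<epsilon> T where \<epsilon>: "0 < \<epsilon>"
      and T: "\<And>t. t \<ge> T \<Longrightarrow> prob (rep_ball \<phi> x t \<epsilon>) < exp (- s1 * t)"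
      using less_lower_local_entropyD[OF flow prob sets] by blast
    define m where "m = max (nat \<lceil>T\<rceil>) (nat \<lceil>inverse \<epsilon>\<rceil>)"
    have m: "T \<le> real m" "inverse \<epsilon> \<le> real (Suc m)" unfolding m_def by linarith+
    have "inverse (real (Suc m)) \<le> \<epsilon>"
      using le_imp_inverse_le[OF m(2)] \<epsilon> by simp
    then have "prob (rep_ball \<phi> x t (inverse (real (Suc m)))) < exp (- s1 * t)" if "t \<ge> real m" for t
      by (intro le_less_trans[OF finite_measure_mono T] rep_ball_mono meas) (use that m(1) in auto)
    with \<open>x \<in> E\<close> have "x \<in> A m" unfolding A_def by simp
    with N(2) show "x \<in> (\<Union>m. N m)" by blast
  qed
  moreover have "(\<Union>m. N m) \<in> null_sets \<mu>" using N(1) by (rule null_sets_UN)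
  ultimately have "measure \<mu> E \<le> measure \<mu> (\<Union>m. N m)"
    by (intro finite_measure_mono) auto
  also have "\<dots> = 0" using \<open>(\<Union>m. N m) \<in> null_sets \<mu>\<close> by (simp add: measure_eq_0_null_sets)
  finally show ?thesis by (simp add: measure_le_0_iff)
qed

theorem theorem1p4:
  fixes \<phi> :: "real \<Rightarrow> 'a::metric_space \<Rightarrow> 'a"
    and \<mu> :: "'a measure" and E :: "'a set" and s :: real
  assumes "compact_metric_flow \<phi>"
    and "without_fixed_points \<phi>"
    and "\<mu> \<in> ergodic_measures \<phi>"
    and "E \<in> sets borel"
    and "0 < s"
  shows "((\<forall>x\<in>E. lower_local_entropy \<phi> \<mu> x \<le> ereal s) \<longrightarrow> bowen_entropy \<phi> E \<le> ereal s) \<and>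
         ((\<forall>x\<in>E. lower_local_entropy \<phi> \<mu> x \<ge> ereal s) \<and> measure \<mu> E > 0
            \<longrightarrow> bowen_entropy \<phi> E \<ge> ereal s)"
proof (intro conjI impI)
  have \<mu>: "prob_space \<mu>" "sets \<mu> = sets borel"
    using assms(3) unfolding ergodic_measures_def invariant_measures_def by auto
  show "bowen_entropy \<phi> E \<le> ereal s" if "\<forall>x\<in>E. lower_local_entropy \<phi> \<mu> x \<le> ereal s"
  proof (rule ereal_le_epsilon2)
    fix \<delta> :: real assume "0 < \<delta>"
    \<comment> \<open>Vanishing is available only strictly above \<open>s\<close>, since the time
      loss must be absorbed; the infimum removes \<open>\<delta>\<close>.\<close>
    have "bowen_M \<phi> E (s + \<delta>) = 0"
      by (rule bowen_M_eq_0_if_lower_local_entropy_le[OF assms(1,2) \<mu> assms(5)])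
        (use that \<open>0 < \<delta>\<close> in auto)
    then have "bowen_entropy \<phi> E \<le> ereal (s + \<delta>)"
      unfolding bowen_entropy_def by (intro Inf_lower) (use \<open>0 < \<delta>\<close> assms(5) in force)
    then show "bowen_entropy \<phi> E \<le> ereal s + ereal \<delta>" by simp
  qed
  show "ereal s \<le> bowen_entropy \<phi> E"
    if "(\<forall>x\<in>E. ereal s \<le> lower_local_entropy \<phi> \<mu> x) \<and> 0 < measure \<mu> E"
    unfolding bowen_entropy_def
  proof (rule Inf_greatest, clarify, rule ccontr)
    fix s' assume "0 \<le> s'" "bowen_M \<phi> E s' = 0" "\<not> ereal s \<le> ereal s'"
    then have "measure \<mu> E = 0"
      using measure_eq_0_if_lower_local_entropy_ge[OF assms(1,2) \<mu>, of s' s E] that by simp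
    with that show False by simp
  qed
qed

end
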